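(* If $n \geq 2$, then $$\mathrm{tot}_n(212)=\frac{(n-2)(3^{n-3}-1)}{4}, \qquad \mathrm{tot}_n(312)=\frac{(n-5)3^{n-3}+n-1}{4}.$$ If $n \geq 1$, then $$f_n(212)=1+\sum_{j=2}^n\sum_{p=1}^{\lfloor j/2\rfloor}\sum_{r=0}^{p-1}\binom{p-1}{r}\binom{j-p}{p+r}\binom{n-p+r}{j-1}$$ and $$f_n(312)=1+\sum_{j=2}^n\sum_{p=1}^{\lfloor j/2\rfloor}\sum_{r=0}^{p-1}\binom{p-1}{r}\binom{j-p}{p+r}\binom{n-r-1}{j-1}.$$
   Context: A Catalan word of length $n\geq 1$ is an integer sequence $\pi=\pi_1\cdots\pi_n$ with $\pi_1=1$ and $1\leq \pi_{i+1}\leq \pi_i+1$ for $1\leq i\leq n-1$. A (weakly) increasing run of a word is a maximal nondecreasing string of consecutive letters. A Catalan word is flattened if the sequence of first letters of its increasing runs, read from left to right, is nondecreasing. $\mathcal{F}_n$ is the set of flattened Catalan words of length $n$. An occurrence of a pattern $\tau=\tau_1\cdots\tau_m$ in $\pi$ as a consecutive (subword) pattern is an index $i$ such that $\pi_i\pi_{i+1}\cdots\pi_{i+m-1}$ is order-isomorphic to $\tau$; $\pi$ avoids $\tau$ if it has no occurrence of $\tau$. $\mathrm{tot}_n(\tau)$ denotes the total number of occurrences of $\tau$ in all the members of $\mathcal{F}_n$, and $f_n(\tau)$ denotes the number of members of $\mathcal{F}_n$ that avoid $\tau$. Binomial coefficients $\binom{a}{b}$ with $0\leq a<b$ are zero.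 *)

theory Defs
  imports Complex_Main
begin

text \<open>Words are lists over \<^typ>\<open>nat\<close>; positions are counted from 0 as usual for lists, so the letter
  $\pi_{i+1}$ is \<^term>\<open>w ! i\<close>.\<close>

definition catalan_word :: "nat list \<Rightarrow> bool" where
  "catalan_word w \<longleftrightarrow> w \<noteq> [] \<and> w ! 0 = 1 \<and>
     (\<forall>i. Suc i < length w \<longrightarrow> 1 \<le> w ! Suc i \<and> w ! Suc i \<le> w ! i + 1)"

text \<open>The letters at positions \<open>i, \<dots>, j\<close> (both included) form a nonempty nondecreasing string.\<close>

definition nondecreasing_segment :: "nat list \<Rightarrow> nat \<Rightarrow> nat \<Rightarrow> bool" where
  "nondecreasing_segment w i j \<longleftrightarrow> i \<le> j \<and> j < length w \<and>
     (\<forall>k. i \<le> k \<and> k < j \<longrightarrow> w ! k \<le> w ! Suc k)"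

definition increasing_run :: "nat list \<Rightarrow> nat \<Rightarrow> nat \<Rightarrow> bool" where
  "increasing_run w i j \<longleftrightarrow> nondecreasing_segment w i j \<and>
     (\<forall>i' j'. i' \<le> i \<and> j \<le> j' \<and> nondecreasing_segment w i' j' \<longrightarrow> i' = i \<and> j' = j)"

text \<open>By maximality, distinct runs start at distinct positions, so enumerating the starting positions
  in increasing order lists every run exactly once, from left to right.\<close>

definition run_first_letters :: "nat list \<Rightarrow> nat list" where
  "run_first_letters w = map (\<lambda>i. w ! i) (filter (\<lambda>i. \<exists>j. increasing_run w i j) [0..<length w])"

definition flattened :: "nat list \<Rightarrow> bool" where
  "flattened w \<longleftrightarrow> sorted (run_first_letters w)"

definition flattened_catalan_words :: "nat \<Rightarrow> nat list set" where
  "flattened_catalan_words n = {w. catalan_word w \<and> flattened w \<and> length w = n}"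

definition order_isomorphic :: "nat list \<Rightarrow> nat list \<Rightarrow> bool" where
  "order_isomorphic u v \<longleftrightarrow> length u = length v \<and>
     (\<forall>i<length u. \<forall>j<length u. u ! i < u ! j \<longleftrightarrow> v ! i < v ! j)"

definition occurrences :: "nat list \<Rightarrow> nat list \<Rightarrow> nat set" where
  "occurrences \<tau> w =
     {i. i + length \<tau> \<le> length w \<and> order_isomorphic (take (length \<tau>) (drop i w)) \<tau>}"

definition avoids :: "nat list \<Rightarrow> nat list \<Rightarrow> bool" where
  "avoids w \<tau> \<longleftrightarrow> occurrences \<tau> w = {}"

definition tot :: "nat \<Rightarrow> nat list \<Rightarrow> nat" where
  "tot n \<tau> = (\<Sum>w\<in>flattened_catalan_words n. card (occurrences \<tau> w))"

definition num_avoiding :: "nat \<Rightarrow> nat list \<Rightarrow> nat" where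
  "num_avoiding n \<tau> = card {w \<in> flattened_catalan_words n. avoids w \<tau>}"

text \<open>The sum and the cardinalities above range over finite sets.\<close>

lemma catalan_word_nth_le:
  assumes "catalan_word w" "i < length w"
  shows "w ! i \<le> Suc i"
  using assms(2)
proof (induction i)
  case 0
  then show ?case using assms(1) by (simp add: catalan_word_def)
next
  case (Suc i)
  then have "w ! Suc i \<le> w ! i + 1" using assms(1) by (simp add: catalan_word_def)
  with Suc show ?case by simp
qed

lemma finite_flattened_catalan_words: "finite (flattened_catalan_words n)"
proof (rule finite_subset)
  show "flattened_catalan_words n \<subseteq> {w. set w \<subseteq> {..n} \<and> length w = n}"
  proof (clarsimp simp: flattened_catalan_words_def in_set_conv_nth)
    fix w i
    assume "catalan_word w" and i: "i < length w"
    then show "w ! i \<le> length w"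
      using catalan_word_nth_le[of w i] by linarith
  qed
  show "finite {w. set w \<subseteq> {..n} \<and> length w = n}"
    by (rule finite_lists_length_eq) simp
qed

lemma finite_occurrences: "finite (occurrences \<tau> w)"
  by (rule finite_subset[of _ "{..length w}"]) (auto simp: occurrences_def)

end

theory Submission
  imports Defs "HOL-Computational_Algebra.Formal_Power_Series"
begin

text \<open>Read a flattened Catalan word from left to right and remember only the first letter \<open>m\<close> of the current
increasing run and the last letter \<open>c\<close> read. The next letter is \<open>c\<close> or \<open>c + 1\<close>, or it starts a new run:
then it is some \<open>x\<close> with \<open>m \<le> x < c\<close>, and both remembered letters become \<open>x\<close>. So the number of
continuations depends only on the excess \<open>c - m\<close> and satisfies a simple recurrence in the number of letters
still to come.

A valley \<open>a x y\<close> with \<open>a > x < y\<close> has \<open>y = x + 1\<close>. Hence it is an occurrence of 212 if the descent from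
\<open>a\<close> to \<open>x\<close> has size 1 and an occurrence of 312 if that descent has size at least 2. From a state with
\<open>c > m\<close> exactly one of the \<open>c - m\<close> possible descents has size 1. This makes every quantity of interest affine in
\<open>c - m\<close> as long as \<open>c > m\<close>, with a separate value at \<open>c = m\<close>, so that each recurrence collapses to a few
coefficients. For the total number of occurrences they have explicit solutions
(\<open>total_one_step_descents\<close>, \<open>total_longer_descents\<close>). For the avoiding words they give
$1 + [x^n]\, x^2 / ((1 - 2x)^2 - R)$, where $R = 2x^3$ for 212 and $R = x^2(1 - x)$ for 312
(\<open>avoiders_one_step_descents\<close>, \<open>avoiders_longer_descents\<close>).

It remains to see that the triple sums are the coefficients of the same series. The sum over \<open>j\<close> is a binomial
transform of binomial coefficients, whose generating function is a product of powers of $x$, $1/(1-x)$ and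
$1/(1-2x)$ (\<open>binomial_series_eq\<close>); the sum over \<open>r\<close> is then an instance of the binomial theorem, in which all
factors $1/(1-x)$ cancel, and the sum over \<open>p\<close> becomes geometric with ratio $R/(1-2x)^2$
(\<open>triple_sum_212\<close>, \<open>triple_sum_312\<close>).\<close>

section \<open>Flattened Catalan words letter by letter\<close>

lemma increasing_run_start_iff:
  "(\<exists>j. increasing_run w i j) \<longleftrightarrow> i < length w \<and> (i = 0 \<or> w ! i < w ! (i - 1))"
proof
  assume "\<exists>j. increasing_run w i j"
  then obtain j where j: "increasing_run w i j" ..
  then have seg: "nondecreasing_segment w i j" by (simp add: increasing_run_def)
  have "i = 0 \<or> w ! i < w ! (i - 1)"
  proof (rule ccontr)
    assume "\<not> ?thesis"
    then have i: "i > 0" "w ! (i - 1) \<le> w ! i" by auto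
    have "w ! k \<le> w ! Suc k" if "i - 1 \<le> k" "k < j" for k
      using that seg i by (cases "k = i - 1") (auto simp: nondecreasing_segment_def)
    with seg have "nondecreasing_segment w (i - 1) j"
      by (auto simp: nondecreasing_segment_def)
    with j have "i - 1 = i" unfolding increasing_run_def by (meson diff_le_self le_refl)
    with i show False by simp
  qed
  with seg show "i < length w \<and> (i = 0 \<or> w ! i < w ! (i - 1))"
    by (auto simp: nondecreasing_segment_def)
next
  assume i: "i < length w \<and> (i = 0 \<or> w ! i < w ! (i - 1))"
  define j where "j = (GREATEST j. nondecreasing_segment w i j)"
  have ex: "nondecreasing_segment w i i" using i by (simp add: nondecreasing_segment_def)
  have bound: "\<And>j. nondecreasing_segment w i j \<Longrightarrow> j \<le> length w"
    by (simp add: nondecreasing_segment_def)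
  have seg: "nondecreasing_segment w i j"
    unfolding j_def by (rule GreatestI_nat[where P = "nondecreasing_segment w i", OF ex bound])
  have "i' = i \<and> j' = j" if "i' \<le> i" "j \<le> j'" "nondecreasing_segment w i' j'" for i' j'
  proof -
    have "i' = i"
    proof (rule ccontr)
      assume "i' \<noteq> i"
      with that have "i' \<le> i - 1" "i - 1 < j'" "i > 0"
        using seg by (auto simp: nondecreasing_segment_def)
      with that(3) have "w ! (i - 1) \<le> w ! i"
        unfolding nondecreasing_segment_def by (metis Suc_pred')
      with i \<open>i > 0\<close> show False by simp
    qed
    moreover have "j' \<le> j"
      unfolding j_def using that(3) \<open>i' = i\<close>
      by (intro Greatest_le_nat[where P = "nondecreasing_segment w i", OF _ bound]) simp
    ultimately show ?thesis using that by simp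
  qed
  with seg show "\<exists>j. increasing_run w i j" unfolding increasing_run_def by blast
qed

text \<open>The argument \<open>c\<close> is the letter that precedes the list, so a descent into its head is seen.\<close>

fun descent_bottoms :: "nat \<Rightarrow> nat list \<Rightarrow> nat list" where
  "descent_bottoms c [] = []"
| "descent_bottoms c (x # v) = (if x < c then [x] else []) @ descent_bottoms x v"

lemma run_first_letters_Cons: "run_first_letters (c # v) = c # descent_bottoms c v"
proof -
  have bottoms: "map (\<lambda>i. (c # v) ! Suc i) (filter (\<lambda>i. (c # v) ! Suc i < (c # v) ! i) [0..<length v])
      = descent_bottoms c v"
  proof (induction v arbitrary: c)
    case (Cons x v)
    have "[0..<length (x # v)] = 0 # map Suc [0..<length v]"
      by (simp add: map_Suc_upt upt_conv_Cons del: upt_Suc)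
    then show ?case
      using Cons[of x] by (simp add: filter_map o_def del: upt_Suc)
  qed simp
  have "[0..<length (c # v)] = 0 # map Suc [0..<length v]"
    by (simp add: map_Suc_upt upt_conv_Cons del: upt_Suc)
  moreover have "filter (\<lambda>i. \<exists>j. increasing_run (c # v) (Suc i) j) [0..<length v]
      = filter (\<lambda>i. (c # v) ! Suc i < (c # v) ! i) [0..<length v]"
    by (rule filter_cong) (auto simp: increasing_run_start_iff)
  ultimately show ?thesis
    using bottoms
    by (simp add: run_first_letters_def filter_map o_def increasing_run_start_iff[of _ 0] del: upt_Suc)
qed

text \<open>The continuations of a word whose current run starts with \<open>m\<close> and whose last letter is \<open>c\<close>. The run starts need
only be compared with their predecessor \<open>m\<close>, and after a descent to \<open>x\<close> both parameters are \<open>x\<close>. Positivity of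
the letters follows from \<open>1 \<le> m\<close>.\<close>

fun admissible :: "nat \<Rightarrow> nat \<Rightarrow> nat list \<Rightarrow> bool" where
  "admissible m c [] \<longleftrightarrow> True"
| "admissible m c (x # v) \<longleftrightarrow>
     (if c \<le> x then x \<le> c + 1 \<and> admissible m x v else m \<le> x \<and> admissible x x v)"

lemma admissible_iff:
  assumes "1 \<le> m" "m \<le> c"
  shows "admissible m c v \<longleftrightarrow>
    (\<forall>i<length v. 1 \<le> v ! i \<and> v ! i \<le> (c # v) ! i + 1) \<and> sorted (m # descent_bottoms c v)"
  using assms
proof (induction v arbitrary: m c)
  case (Cons x v)
  have split: "(\<forall>i<length (x # v). 1 \<le> (x # v) ! i \<and> (x # v) ! i \<le> (c # x # v) ! i + 1) \<longleftrightarrow>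
      1 \<le> x \<and> x \<le> c + 1 \<and> (\<forall>i<length v. 1 \<le> v ! i \<and> v ! i \<le> (x # v) ! i + 1)"
    by (auto simp: All_less_Suc2)
  show ?case
  proof (cases "c \<le> x")
    case True
    then show ?thesis using Cons.prems unfolding split by (auto simp: Cons.IH)
  next
    case False
    then show ?thesis
      using Cons.prems Cons.IH[of x x] unfolding split
      by (cases "m \<le> x") (auto intro: order_trans)
  qed
qed simp

definition suffixes :: "nat \<Rightarrow> nat \<Rightarrow> nat \<Rightarrow> nat list set" where
  "suffixes m c k = {v. length v = k \<and> admissible m c v}"

lemma flattened_catalan_words_Suc:
  "flattened_catalan_words (Suc k) = Cons 1 ` suffixes 1 1 k"
proof -
  have "catalan_word (1 # v) \<longleftrightarrow> (\<forall>i<length v. 1 \<le> v ! i \<and> v ! i \<le> (1 # v) ! i + 1)" for v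
    by (auto simp: catalan_word_def)
  then have eq: "catalan_word (1 # v) \<and> flattened (1 # v) \<longleftrightarrow> admissible 1 1 v" for v
    using admissible_iff[of 1 1 v] by (simp add: flattened_def run_first_letters_Cons)
  have "w \<in> flattened_catalan_words (Suc k) \<longleftrightarrow> w \<in> Cons 1 ` suffixes 1 1 k" for w
  proof (cases w)
    case Nil
    then show ?thesis by (auto simp: flattened_catalan_words_def)
  next
    case (Cons a v)
    show ?thesis
    proof (cases "a = 1")
      case True
      with Cons eq[of v] show ?thesis
        by (auto simp: flattened_catalan_words_def suffixes_def)
    next
      case False
      with Cons show ?thesis
        by (auto simp: flattened_catalan_words_def catalan_word_def)
    qed
  qed
  then show ?thesis by blast
qed

lemma suffixes_0: "suffixes m c 0 = {[]}"
  by (auto simp: suffixes_def)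

lemma suffixes_Suc:
  assumes "m \<le> c"
  shows "suffixes m c (Suc k) = Cons c ` suffixes m c k \<union> Cons (c + 1) ` suffixes m (c + 1) k \<union>
    (\<Union>x\<in>{m..<c}. Cons x ` suffixes x x k)"
proof -
  have "w \<in> suffixes m c (Suc k) \<longleftrightarrow> w \<in> Cons c ` suffixes m c k \<union>
      Cons (c + 1) ` suffixes m (c + 1) k \<union> (\<Union>x\<in>{m..<c}. Cons x ` suffixes x x k)" for w
    by (cases w) (auto simp: suffixes_def le_Suc_eq)
  then show ?thesis by blast
qed

lemma finite_suffixes: "m \<le> c \<Longrightarrow> finite (suffixes m c k)"
  by (induction k arbitrary: m c) (simp_all add: suffixes_0 suffixes_Suc)

lemma sum_suffixes_Suc:
  fixes f :: "nat list \<Rightarrow> real"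
  assumes "m \<le> c"
  shows "(\<Sum>v\<in>suffixes m c (Suc k). f v) =
    (\<Sum>v\<in>suffixes m c k. f (c # v)) + (\<Sum>v\<in>suffixes m (c + 1) k. f ((c + 1) # v)) +
    (\<Sum>x=m..<c. \<Sum>v\<in>suffixes x x k. f (x # v))"
proof -
  let ?A = "Cons c ` suffixes m c k" and ?B = "Cons (c + 1) ` suffixes m (c + 1) k"
    and ?C = "\<Union>x\<in>{m..<c}. Cons x ` suffixes x x k"
  have fin: "finite ?A" "finite ?B" "finite ?C" using assms by (simp_all add: finite_suffixes)
  have "(\<Sum>v\<in>suffixes m c (Suc k). f v) = sum f ?A + sum f ?B + sum f ?C"
    unfolding suffixes_Suc[OF assms] using fin
    by (subst sum.union_disjoint, (auto)[3])+ simp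
  moreover have "sum f ?C = (\<Sum>x=m..<c. sum f (Cons x ` suffixes x x k))"
    by (rule sum.UNION_disjoint) (auto simp: finite_suffixes)
  ultimately show ?thesis by (simp add: sum.reindex)
qed

text \<open>The recurrence maps affine functions of \<open>c - m\<close> to affine functions; \<open>3 ^ k + 1\<close> and \<open>3 ^ k - 1\<close> are the
solutions of the resulting recurrence for twice the two coefficients. With excess 1 the number is \<open>3 ^ k\<close>.\<close>

lemma card_suffixes:
  assumes "m \<le> c"
  shows "2 * real (card (suffixes m c k)) = (3 ^ k + 1) + (real c - real m) * (3 ^ k - 1)"
  using assms
proof (induction k arbitrary: m c)
  case (Suc k)
  have same: "2 * real (card (suffixes x x k)) = 3 ^ k + 1" for x
    using Suc.IH[of x x] by simp
  have "2 * (\<Sum>x=m..<c. real (card (suffixes x x k))) = (real c - real m) * (3 ^ k + 1)"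
    unfolding sum_distrib_left same using Suc.prems by (simp add: of_nat_diff)
  then show ?case
    using sum_suffixes_Suc[OF Suc.prems, where k = k and f = "\<lambda>_. 1"] Suc.IH[of m c] Suc.IH[of m "c + 1"] Suc.prems
    by (simp add: algebra_simps)
qed (simp add: suffixes_0)

text \<open>Directly after a descent to \<open>x\<close>, these are the continuations that turn the descent into a valley.\<close>

definition rising_suffixes :: "nat \<Rightarrow> nat \<Rightarrow> nat list set" where
  "rising_suffixes x k = {v \<in> suffixes x x k. v \<noteq> [] \<and> x < hd v}"

lemma card_rising_suffixes:
  "real (card (rising_suffixes x k)) = (if k = 0 then 0 else 3 ^ (k - 1))"
proof (cases k)
  case (Suc l)
  have "rising_suffixes x k = Cons (x + 1) ` suffixes x (x + 1) l"
    by (auto simp: rising_suffixes_def Suc suffixes_Suc)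
  then show ?thesis
    using card_suffixes[of x "x + 1" l] by (simp add: card_image Suc)
qed (simp add: rising_suffixes_def suffixes_0)

section \<open>Occurrences of a pattern at a valley\<close>

lemma order_isomorphic_three:
  "order_isomorphic [a, x, y] [b, u, v] \<longleftrightarrow>
    (a < x \<longleftrightarrow> b < u) \<and> (x < a \<longleftrightarrow> u < b) \<and> (a < y \<longleftrightarrow> b < v) \<and> (y < a \<longleftrightarrow> v < b) \<and>
    (x < y \<longleftrightarrow> u < v) \<and> (y < x \<longleftrightarrow> v < u)"
  by (auto simp: order_isomorphic_def All_less_Suc2 numeral_3_eq_3)

lemma occurrences_Cons:
  "occurrences \<tau> (a # w) =
    (if length \<tau> \<le> Suc (length w) \<and> order_isomorphic (take (length \<tau>) (a # w)) \<tau> then {0} else {})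
      \<union> Suc ` occurrences \<tau> w"
proof -
  have "i \<in> occurrences \<tau> (a # w) \<longleftrightarrow> i \<in>
    (if length \<tau> \<le> Suc (length w) \<and> order_isomorphic (take (length \<tau>) (a # w)) \<tau> then {0} else {})
      \<union> Suc ` occurrences \<tau> w" for i
    by (cases i) (auto simp: occurrences_def)
  then show ?thesis by blast
qed

lemma card_occurrences_Cons:
  "card (occurrences \<tau> (a # w)) =
    of_bool (length \<tau> \<le> Suc (length w) \<and> order_isomorphic (take (length \<tau>) (a # w)) \<tau>) +
    card (occurrences \<tau> w)"
proof -
  have "card ({0} \<union> Suc ` occurrences \<tau> w) = 1 + card (occurrences \<tau> w)"
    by (subst card_Un_disjoint) (auto simp: card_image finite_occurrences)
  then show ?thesis by (simp add: occurrences_Cons card_image)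
qed

text \<open>The common shape of 212 and 312 inside these words: an occurrence is a valley \<open>a x y\<close> whose descent size \<open>a - x\<close>
is selected by \<open>J\<close>. The bound \<open>y \<le> x + 1\<close> is the growth condition of Catalan words.\<close>

locale valley_pattern =
  fixes \<tau> :: "nat list" and J :: "nat \<Rightarrow> bool"
  assumes length_pattern: "length \<tau> = 3"
    and isomorphic_iff:
      "y \<le> x + 1 \<Longrightarrow> order_isomorphic [a, x, y] \<tau> \<longleftrightarrow> x < y \<and> x < a \<and> J (a - x)"
begin

definition occ :: "nat list \<Rightarrow> nat" where
  "occ w = card (occurrences \<tau> w)"

lemma occ_single: "occ [a] = 0"
  by (auto simp: occ_def occurrences_def length_pattern)

text \<open>The next letter can exceed \<open>x\<close> only by 1, so it is enough to know whether it does: the descent from \<open>a\<close> to \<open>x\<close>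
decides the rest.\<close>

lemma occ_Cons_Cons:
  assumes "v \<in> suffixes m x k"
  shows "occ (a # x # v) = of_bool (x < a \<and> J (a - x) \<and> v \<noteq> [] \<and> x < hd v) + occ (x # v)"
proof (cases v)
  case Nil
  then show ?thesis
    unfolding occ_def by (subst card_occurrences_Cons) (simp add: length_pattern)
next
  case (Cons y u)
  with assms have "y \<le> x + 1"
    by (auto simp: suffixes_def split: if_splits)
  from isomorphic_iff[OF this, of a] show ?thesis
    unfolding occ_def Cons
    by (subst card_occurrences_Cons) (simp add: length_pattern numeral_3_eq_3 conj_ac)
qed

text \<open>The last letter \<open>c\<close> of the prefix is kept in front of the continuation because an occurrence may start there.
Occurrences that start earlier are accounted for when the descent inside them is read.\<close>

definition total :: "nat \<Rightarrow> nat \<Rightarrow> nat \<Rightarrow> real" where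
  "total m c k = (\<Sum>v\<in>suffixes m c k. real (occ (c # v)))"

lemma total_0: "total m c 0 = 0"
  by (simp add: total_def suffixes_0 occ_single)

lemma total_Suc:
  assumes "m \<le> c"
  shows "total m c (Suc k) = total m c k + total m (c + 1) k +
    (\<Sum>x=m..<c. total x x k + of_bool (J (c - x)) * (if k = 0 then 0 else 3 ^ (k - 1)))"
proof -
  have "(\<Sum>v\<in>suffixes x x k. real (occ (c # x # v))) =
      total x x k + of_bool (J (c - x)) * (if k = 0 then 0 else 3 ^ (k - 1))" if "x < c" for x
  proof -
    have "(\<Sum>v\<in>suffixes x x k. real (occ (c # x # v))) =
        (\<Sum>v\<in>suffixes x x k. of_bool (J (c - x)) * of_bool (v \<noteq> [] \<and> x < hd v) + real (occ (x # v)))"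
      using that by (intro sum.cong) (auto simp: occ_Cons_Cons)
    also have "\<dots> = of_bool (J (c - x)) * real (card (rising_suffixes x k)) + total x x k"
      by (simp add: sum.distrib total_def rising_suffixes_def finite_suffixes Int_def
          flip: sum_distrib_left)
    finally show ?thesis by (simp add: card_rising_suffixes)
  qed
  moreover have "occ (c # c # v) = occ (c # v)" if "v \<in> suffixes m c k" for v
    using that by (simp add: occ_Cons_Cons)
  moreover have "occ (c # (c + 1) # v) = occ ((c + 1) # v)" if "v \<in> suffixes m (c + 1) k" for v
    using occ_Cons_Cons[OF that, of c] by simp
  ultimately show ?thesis
    unfolding total_def sum_suffixes_Suc[OF assms] by simp
qed

lemma tot_eq_total: "real (tot (Suc k) \<tau>) = total 1 1 k"
  by (simp add: tot_def flattened_catalan_words_Suc sum.reindex total_def occ_def)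

definition avoiders :: "nat \<Rightarrow> nat \<Rightarrow> nat \<Rightarrow> real" where
  "avoiders m c k = (\<Sum>v\<in>suffixes m c k. of_bool (occ (c # v) = 0))"

lemma avoiders_0: "avoiders m c 0 = 1"
  by (simp add: avoiders_def suffixes_0 occ_single)

text \<open>After a descent selected by \<open>J\<close> an avoiding word either ends or repeats the bottom letter \<open>x\<close>, which leaves
the state unchanged but disarms the descent; hence the value at \<open>k - 1\<close>.\<close>

lemma avoiders_Suc:
  assumes "m \<le> c"
  shows "avoiders m c (Suc k) = avoiders m c k + avoiders m (c + 1) k +
    (\<Sum>x=m..<c. if J (c - x) then (if k = 0 then 1 else avoiders x x (k - 1)) else avoiders x x k)"
proof -
  have "(\<Sum>v\<in>suffixes x x k. of_bool (occ (c # x # v) = 0)) =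
      (if J (c - x) then (if k = 0 then 1 else avoiders x x (k - 1)) else avoiders x x k)"
    if "x < c" for x
  proof (cases "J (c - x)")
    case False
    then show ?thesis unfolding avoiders_def by (simp add: occ_Cons_Cons)
  next
    case J: True
    show ?thesis
    proof (cases k)
      case 0
      then show ?thesis using J occ_Cons_Cons[of "[]" x x 0 c] by (simp add: suffixes_0 occ_single)
    next
      case (Suc l)
      have "occ (c # x # x # v) = occ (x # v)" if "v \<in> suffixes x x l" for v
        using occ_Cons_Cons[of "x # v" x x "Suc l" c] occ_Cons_Cons[of v x x l x] that
        by (simp add: suffixes_Suc)
      moreover have "occ (c # x # (x + 1) # v) \<noteq> 0" if "v \<in> suffixes x (x + 1) l" for v
        using occ_Cons_Cons[of "(x + 1) # v" x x "Suc l" c] that J \<open>x < c\<close>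
        by (simp add: suffixes_Suc)
      ultimately show ?thesis
        unfolding Suc sum_suffixes_Suc[OF order_refl] using J
        by (simp add: avoiders_def sum.neutral)
    qed
  qed
  moreover have "occ (c # c # v) = occ (c # v)" if "v \<in> suffixes m c k" for v
    using that by (simp add: occ_Cons_Cons)
  moreover have "occ (c # (c + 1) # v) = occ ((c + 1) # v)" if "v \<in> suffixes m (c + 1) k" for v
    using occ_Cons_Cons[OF that, of c] by simp
  ultimately show ?thesis
    unfolding avoiders_def sum_suffixes_Suc[OF assms] by simp
qed

lemma num_avoiding_eq_avoiders: "real (num_avoiding (Suc k) \<tau>) = avoiders 1 1 k"
proof -
  have "{w \<in> flattened_catalan_words (Suc k). avoids w \<tau>} =
      Cons 1 ` {v \<in> suffixes 1 1 k. occ (1 # v) = 0}"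
    by (auto simp: flattened_catalan_words_Suc avoids_def occ_def finite_occurrences)
  then show ?thesis
    by (simp add: num_avoiding_def card_image avoiders_def finite_suffixes Int_def)
qed

end

section \<open>Closed forms for the totals\<close>

text \<open>Exactly one of the possible descents from \<open>c\<close>, the one to \<open>c - 1\<close>, has size 1.\<close>

lemma sum_last_descent:
  fixes m c :: nat and s t :: real
  assumes "m \<le> c"
  shows "(\<Sum>x=m..<c. if c - x = 1 then s else t) =
    (if c = m then 0 else s + (real c - real m - 1) * t)"
proof (cases "c = m")
  case False
  with assms obtain b where b: "c = Suc b" "m \<le> b" by (cases c) auto
  have "(\<Sum>x=m..<b. if c - x = 1 then s else t) = (\<Sum>x=m..<b. t)"
    by (intro sum.cong) (auto simp: b)
  then show ?thesis using b by (simp add: of_nat_diff)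
qed simp

text \<open>The value for \<open>c = m\<close> at \<open>k + 1\<close> is the sum of the values for \<open>c = m\<close> and \<open>c = m + 1\<close> at \<open>k\<close>, so the closed form on the
diagonal determines the value for excess 1, and the recurrence at excess 1 then determines the slope in \<open>c - m\<close>.
All three are checked together by induction. The induction starts at one further letter because the total for
none, which is 0, does not fit the closed form.\<close>

lemma (in valley_pattern) total_one_step_descents:
  assumes J: "\<And>s. J s \<longleftrightarrow> s = 1" and "m \<le> c"
  shows "total m c (Suc k) = (if c = m then k * (3 ^ k / 3 - 1)
    else (2 * k + 3) * 3 ^ k / 3 - 1 + (real c - real m - 1) * ((real k - 3) * 3 ^ k / 3 + k + 1)) / 4"
  using assms(2)
proof (induction k arbitrary: m c)
  case 0
  then show ?case by (simp add: total_Suc total_0)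
next
  case (Suc k)
  let ?t = "k * (3 ^ k / 3 - 1) / 4 :: real"
  have same: "total x x (Suc k) = ?t" for x
    using Suc.IH[of x x] by simp
  have "(\<Sum>x=m..<c. total x x (Suc k) + of_bool (J (c - x)) * 3 ^ k) =
      (\<Sum>x=m..<c. if c - x = 1 then ?t + 3 ^ k else ?t)"
    by (intro sum.cong) (auto simp: same J)
  also note sum_last_descent[OF Suc.prems]
  finally have valleys: "(\<Sum>x=m..<c. total x x (Suc k) + of_bool (J (c - x)) * 3 ^ k) =
      (if c = m then 0 else ?t + 3 ^ k + (real c - real m - 1) * ?t)" .
  show ?case
    using Suc.prems valleys
    by (simp add: total_Suc[of m c "Suc k"] Suc.IH) (simp add: field_simps)
qed

lemma (in valley_pattern) total_longer_descents:
  assumes J: "\<And>s. J s \<longleftrightarrow> s \<noteq> 1" and "m \<le> c"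
  shows "total m c (Suc k) = (if c = m then (real k - 3) * 3 ^ k / 3 + k + 1
    else (2 * real k - 3) * 3 ^ k / 3 + 1 + (real c - real m - 1) * ((k + 6) * 3 ^ k / 3 - k - 2)) / 4"
  using assms(2)
proof (induction k arbitrary: m c)
  case 0
  then show ?case by (simp add: total_Suc total_0)
next
  case (Suc k)
  let ?t = "((real k - 3) * 3 ^ k / 3 + k + 1) / 4"
  have same: "total x x (Suc k) = ?t" for x
    using Suc.IH[of x x] by simp
  have "(\<Sum>x=m..<c. total x x (Suc k) + of_bool (J (c - x)) * 3 ^ k) =
      (\<Sum>x=m..<c. if c - x = 1 then ?t else ?t + 3 ^ k)"
    by (intro sum.cong) (auto simp: same J)
  also note sum_last_descent[OF Suc.prems]
  finally have valleys: "(\<Sum>x=m..<c. total x x (Suc k) + of_bool (J (c - x)) * 3 ^ k) =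
      (if c = m then 0 else ?t + (real c - real m - 1) * (?t + 3 ^ k))" .
  show ?case
    using Suc.prems valleys
    by (simp add: total_Suc[of m c "Suc k"] Suc.IH) (simp add: field_simps)
qed

section \<open>Generating functions of the avoiders\<close>

text \<open>For the two patterns the denominator is a cubic polynomial. It is written in terms of \<open>R\<close> because the series is
also the sum of a geometric series with ratio $R/(1-2x)^2$.\<close>

definition cubic_series :: "real fps \<Rightarrow> real fps" where
  "cubic_series R = fps_X ^ 2 * inverse ((1 - 2 * fps_X) ^ 2 - R)"

lemma inverse_one_minus_X: "inverse (1 - fps_X) * (1 - fps_X) = (1 :: real fps)"
  by (rule inverse_mult_eq_1) simp

lemma inverse_one_minus_2X: "inverse (1 - 2 * fps_X) * (1 - 2 * fps_X) = (1 :: real fps)"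
  by (rule inverse_mult_eq_1) simp

lemma cubic_series_mult:
  assumes "fps_nth R 0 = 0"
  shows "cubic_series R * ((1 - 2 * fps_X) ^ 2 - R) = fps_X ^ 2"
  unfolding cubic_series_def mult.assoc using assms
  by (subst inverse_mult_eq_1) (simp_all add: fps_power_zeroth)

lemma fps_nth_cubic_recurrence:
  fixes H :: "real fps"
  assumes "H * (1 - fps_const a * fps_X + fps_const b * fps_X ^ 2 + fps_const d * fps_X ^ 3) = fps_X ^ 2"
  shows "fps_nth H 0 = 0" "fps_nth H (Suc 0) = 0" "fps_nth H (Suc (Suc 0)) = 1"
    "fps_nth H (Suc (Suc (Suc n))) =
       a * fps_nth H (Suc (Suc n)) - b * fps_nth H (Suc n) - d * fps_nth H n"
proof -
  have H: "H = fps_X ^ 2 + fps_const a * (fps_X * H) - fps_const b * (fps_X ^ 2 * H)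
      - fps_const d * (fps_X ^ 3 * H)"
    using assms by (simp add: algebra_simps)
  note nth = arg_cong[OF H, of "\<lambda>H. fps_nth H _", simplified fps_sub_nth fps_add_nth
    fps_mult_left_const_nth fps_X_mult_nth fps_X_power_mult_nth fps_X_power_nth]
  show h0: "fps_nth H 0 = 0" by (subst nth) simp
  show h1: "fps_nth H (Suc 0) = 0" by (subst nth) (simp add: h0)
  show h2: "fps_nth H (Suc (Suc 0)) = 1" by (subst nth) (simp add: h0 h1)
  show "fps_nth H (Suc (Suc (Suc n))) =
       a * fps_nth H (Suc (Suc n)) - b * fps_nth H (Suc n) - d * fps_nth H n"
    by (subst nth) simp
qed

lemma cubic_series_212_nth:
  defines "h \<equiv> fps_nth (cubic_series (2 * fps_X ^ 3))"
  shows "h 0 = 0" "h (Suc 0) = 0" "h (Suc (Suc 0)) = 1"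
    "h (Suc (Suc (Suc n))) = 4 * h (Suc (Suc n)) - 4 * h (Suc n) + 2 * h n"
proof -
  have "cubic_series (2 * fps_X ^ 3) * (1 - fps_const 4 * fps_X + fps_const 4 * fps_X ^ 2
      + fps_const (- 2) * fps_X ^ 3) = fps_X ^ 2"
  proof -
    have "1 - fps_const 4 * fps_X + fps_const 4 * fps_X ^ 2 + fps_const (- 2) * fps_X ^ 3 =
        (1 - 2 * fps_X) ^ 2 - 2 * (fps_X :: real fps) ^ 3"
      unfolding fps_const_neg[symmetric] numeral_fps_const[symmetric] by algebra
    then show ?thesis by (simp only:) (simp add: cubic_series_mult)
  qed
  from fps_nth_cubic_recurrence[OF this] show
    "h 0 = 0" "h (Suc 0) = 0" "h (Suc (Suc 0)) = 1"
    "h (Suc (Suc (Suc n))) = 4 * h (Suc (Suc n)) - 4 * h (Suc n) + 2 * h n"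
    by (simp_all add: h_def)
qed

lemma cubic_series_312_nth:
  defines "h \<equiv> fps_nth (cubic_series (fps_X ^ 2 * (1 - fps_X)))"
  shows "h 0 = 0" "h (Suc 0) = 0" "h (Suc (Suc 0)) = 1"
    "h (Suc (Suc (Suc n))) = 4 * h (Suc (Suc n)) - 3 * h (Suc n) - h n"
proof -
  have "cubic_series (fps_X ^ 2 * (1 - fps_X)) * (1 - fps_const 4 * fps_X + fps_const 3 * fps_X ^ 2
      + fps_const 1 * fps_X ^ 3) = fps_X ^ 2"
  proof -
    have "1 - fps_const 4 * fps_X + fps_const 3 * fps_X ^ 2 + fps_const 1 * fps_X ^ 3 =
        (1 - 2 * fps_X) ^ 2 - fps_X ^ 2 * (1 - (fps_X :: real fps))"
      unfolding fps_const_1_eq_1 numeral_fps_const[symmetric] by algebra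
    then show ?thesis by (simp only:) (simp add: cubic_series_mult)
  qed
  from fps_nth_cubic_recurrence[OF this] show
    "h 0 = 0" "h (Suc 0) = 0" "h (Suc (Suc 0)) = 1"
    "h (Suc (Suc (Suc n))) = 4 * h (Suc (Suc n)) - 3 * h (Suc n) - h n"
    by (simp_all add: h_def)
qed

text \<open>As for the totals, the value on the diagonal fixes the value at excess 1 and the slope, here as linear
combinations of shifts of \<open>h\<close> and a constant. With \<open>E\<close> the shift operator, compatibility of the slope with the recurrence amounts to
$(E - 1)(E^3 - 4E^2 + 4E - 2)h = 0$, a consequence of the recurrence of \<open>h\<close>. The induction needs two
previous lengths because an avoiding word has to repeat the bottom of a one-step descent.\<close>

lemma (in valley_pattern) avoiders_one_step_descents:
  assumes J: "\<And>s. J s \<longleftrightarrow> s = 1" and "m \<le> c"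
  defines "h \<equiv> fps_nth (cubic_series (2 * fps_X ^ 3))"
  shows "avoiders m c k = (if c = m then 1 + h (k + 1) else
    h (k + 2) - h (k + 1) + (real c - real m - 1) *
      (h (k + 3) - 3 * h (k + 2) + 2 * h (k + 1) - h k - 1))"
  using assms(2)
proof (induction k arbitrary: m c rule: less_induct)
  case (less k)
  note h = cubic_series_212_nth[folded h_def]
  show ?case
  proof (cases k)
    case 0
    then show ?thesis by (simp add: avoiders_0 h numeral_3_eq_3)
  next
    case (Suc l)
    have same: "avoiders x x l = 1 + h (l + 1)" for x
      using less.IH[of l x x] Suc by simp
    have prev: "(if l = 0 then 1 else avoiders x x (l - 1)) = 1 + h l" for x
      using less.IH[of "l - 1" x x] Suc by (simp add: h)
    have "(\<Sum>x=m..<c. if J (c - x) then 1 + h l else 1 + h (l + 1)) =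
        (if c = m then 0 else 1 + h l + (real c - real m - 1) * (1 + h (l + 1)))"
      unfolding J by (rule sum_last_descent[OF less.prems])
    then show ?thesis
      using less.prems less.IH[of l m c] less.IH[of l m "c + 1"]
      unfolding Suc avoiders_Suc[OF less.prems] prev same
      by (simp add: h numeral_3_eq_3) (simp add: algebra_simps)
  qed
qed

text \<open>Here the compatibility condition is $(E - 1)(E^3 - 4E^2 + 3E + 1)h = 0$.\<close>

lemma (in valley_pattern) avoiders_longer_descents:
  assumes J: "\<And>s. J s \<longleftrightarrow> s \<noteq> 1" and "m \<le> c"
  defines "h \<equiv> fps_nth (cubic_series (fps_X ^ 2 * (1 - fps_X)))"
  shows "avoiders m c k = (if c = m then 1 + h (k + 1) else
    h (k + 2) - h (k + 1) + (real c - real m - 1) *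
      (h (k + 3) - 3 * h (k + 2) + h (k + 1) - 1))"
  using assms(2)
proof (induction k arbitrary: m c rule: less_induct)
  case (less k)
  note h = cubic_series_312_nth[folded h_def]
  show ?case
  proof (cases k)
    case 0
    then show ?thesis by (simp add: avoiders_0 h numeral_3_eq_3)
  next
    case (Suc l)
    have same: "avoiders x x l = 1 + h (l + 1)" for x
      using less.IH[of l x x] Suc by simp
    have prev: "(if l = 0 then 1 else avoiders x x (l - 1)) = 1 + h l" for x
      using less.IH[of "l - 1" x x] Suc by (simp add: h)
    have "(\<Sum>x=m..<c. if J (c - x) then 1 + h l else 1 + h (l + 1)) =
        (\<Sum>x=m..<c. if c - x = 1 then 1 + h (l + 1) else 1 + h l)"
      by (intro sum.cong) (auto simp: J)
    also note sum_last_descent[OF less.prems]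
    finally show ?thesis
      using less.prems less.IH[of l m c] less.IH[of l m "c + 1"]
      unfolding Suc avoiders_Suc[OF less.prems] prev same
      by (simp add: h numeral_3_eq_3) (simp add: algebra_simps)
  qed
qed

section \<open>The generating function of the triple sums\<close>

text \<open>The binomial transform of the sequence $\binom{i-a}{q}$. For \<open>q \<ge> 1\<close> the truncated subtraction
makes the terms with \<open>i < a\<close> vanish.\<close>

definition binomial_series :: "nat \<Rightarrow> nat \<Rightarrow> real fps" where
  "binomial_series a q = Abs_fps (\<lambda>m. \<Sum>i\<le>m. real (m choose i) * real ((i - a) choose q))"

lemma sum_choose_Suc:
  fixes f :: "nat \<Rightarrow> real"
  shows "(\<Sum>i\<le>Suc m. real (Suc m choose i) * f i) =
    (\<Sum>i\<le>m. real (m choose i) * f i) + (\<Sum>i\<le>m. real (m choose i) * f (Suc i))"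
proof -
  have "(\<Sum>i\<le>Suc m. real (Suc m choose i) * f i) =
      f 0 + (\<Sum>i\<le>m. real (m choose Suc i) * f (Suc i)) + (\<Sum>i\<le>m. real (m choose i) * f (Suc i))"
    by (simp only: sum.atMost_Suc_shift) (simp add: sum.distrib algebra_simps)
  also have "f 0 + (\<Sum>i\<le>m. real (m choose Suc i) * f (Suc i)) = (\<Sum>i\<le>Suc m. real (m choose i) * f i)"
    by (simp only: sum.atMost_Suc_shift) simp
  finally show ?thesis by simp
qed

text \<open>Pascal's rule turns a binomial transform at \<open>m + 1\<close> into the one at \<open>m\<close> plus the one of the shifted sequence, and
the shift lowers \<open>a\<close> by 1.\<close>

lemma binomial_series_Suc_left:
  assumes "q \<ge> 1"
  shows "binomial_series (Suc a) q * (1 - fps_X) = fps_X * binomial_series a q"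
proof (rule fps_ext)
  fix n
  show "fps_nth (binomial_series (Suc a) q * (1 - fps_X)) n = fps_nth (fps_X * binomial_series a q) n"
  proof (cases n)
    case (Suc m)
    then show ?thesis
      using sum_choose_Suc[of m "\<lambda>i. real ((i - Suc a) choose q)"]
      by (simp add: right_diff_distrib binomial_series_def del: sum.atMost_Suc)
  qed (use assms in \<open>simp add: right_diff_distrib binomial_series_def binomial_eq_0\<close>)
qed

text \<open>By Pascal's rule for both binomial coefficients, each increase of \<open>q\<close> contributes a factor $x/(1-2x)$; for
\<open>q = 0\<close> the coefficients are the row sums \<open>2 ^ m\<close>.\<close>

lemma binomial_series_0_left:
  "binomial_series 0 q * (1 - 2 * fps_X) ^ Suc q = fps_X ^ q"
proof (induction q)
  case 0
  have "binomial_series 0 0 * (1 - 2 * fps_X) =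
      binomial_series 0 0 - fps_const 2 * (fps_X * binomial_series 0 0)"
    by (simp add: algebra_simps flip: numeral_fps_const)
  also have "\<dots> = 1"
  proof (rule fps_ext)
    fix n
    have "(\<Sum>i\<le>m. real (m choose i)) = 2 ^ m" for m
      using choose_row_sum[of m] by (metis of_nat_numeral of_nat_power of_nat_sum)
    then show "fps_nth (binomial_series 0 0 - fps_const 2 * (fps_X * binomial_series 0 0)) n =
        fps_nth 1 n"
      by (cases n) (simp_all add: binomial_series_def)
  qed
  finally show ?case by simp
next
  case (Suc q)
  have "binomial_series 0 (Suc q) * (1 - 2 * fps_X) =
      binomial_series 0 (Suc q) - fps_const 2 * (fps_X * binomial_series 0 (Suc q))"
    by (simp add: algebra_simps flip: numeral_fps_const)
  also have "\<dots> = fps_X * binomial_series 0 q"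
  proof (rule fps_ext)
    fix n
    show "fps_nth (binomial_series 0 (Suc q) - fps_const 2 * (fps_X * binomial_series 0 (Suc q))) n =
        fps_nth (fps_X * binomial_series 0 q) n"
    proof (cases n)
      case (Suc m)
      then show ?thesis
        using sum_choose_Suc[of m "\<lambda>i. real (i choose Suc q)"]
        by (simp add: binomial_series_def sum.distrib distrib_left del: sum.atMost_Suc)
    qed (simp add: binomial_series_def)
  qed
  finally have "binomial_series 0 (Suc q) * (1 - 2 * fps_X) = fps_X * binomial_series 0 q" .
  then show ?case using Suc.IH
    by (metis (no_types, lifting) mult.assoc power_Suc)
qed

lemma binomial_series_eq:
  assumes "q \<ge> 1"
  shows "binomial_series a q = fps_X ^ (a + q) * inverse (1 - fps_X) ^ a * inverse (1 - 2 * fps_X) ^ Suc q"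
proof (induction a)
  case 0
  have "(1 - 2 * fps_X) ^ Suc q * inverse (1 - 2 * fps_X) ^ Suc q = (1 :: real fps)"
    by (simp only: power_mult_distrib[symmetric] mult.commute[of "1 - 2 * fps_X"]
        inverse_one_minus_2X power_one)
  then have "binomial_series 0 q =
      binomial_series 0 q * (1 - 2 * fps_X) ^ Suc q * inverse (1 - 2 * fps_X) ^ Suc q"
    by (simp only: mult.assoc mult_1_right)
  then show ?case by (simp only: binomial_series_0_left add_0 power_0 mult_1_right)
next
  case (Suc a)
  have "binomial_series (Suc a) q = binomial_series (Suc a) q * (inverse (1 - fps_X) * (1 - fps_X))"
    by (simp only: inverse_one_minus_X mult_1_right)
  also have "\<dots> = binomial_series (Suc a) q * (1 - fps_X) * inverse (1 - fps_X)"
    by (simp only: mult_ac)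
  also have "\<dots> = fps_X * binomial_series a q * inverse (1 - fps_X)"
    by (simp only: binomial_series_Suc_left[OF assms])
  finally show ?case by (simp only: Suc.IH power_Suc add_Suc mult_ac)
qed

text \<open>The sum over \<open>j\<close> becomes a coefficient of a binomial series, with \<open>j = i + 1\<close> and the factor \<open>fps_X ^ s p r\<close>
realising the shift of \<open>n\<close>. The bounds on \<open>s\<close> ensure
that this shift does not exceed \<open>n\<close> and that terms with \<open>j > n\<close> vanish.\<close>

lemma triple_sum_eq_fps_nth:
  fixes s :: "nat \<Rightarrow> nat \<Rightarrow> nat"
  assumes "n \<ge> 1" and s: "\<And>p r. r < p \<Longrightarrow> 1 \<le> s p r \<and> s p r \<le> p"
  shows "real (\<Sum>j=2..n. \<Sum>p=1..j div 2. \<Sum>r=0..p-1.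
      ((p - 1) choose r) * ((j - p) choose (p + r)) * ((n - s p r) choose (j - 1))) =
    fps_nth (\<Sum>p=1..n. \<Sum>r\<le>p-1.
      of_nat ((p - 1) choose r) * (fps_X ^ s p r * binomial_series (p - 1) (p + r))) n"
proof -
  let ?f = "\<lambda>j p r. real ((p - 1) choose r) * real ((j - p) choose (p + r)) * real ((n - s p r) choose (j - 1))"
  have extend: "(\<Sum>p=1..j div 2. \<Sum>r=0..p-1. ?f j p r) = (\<Sum>p=1..n. \<Sum>r\<le>p-1. ?f j p r)"
    if "j \<le> n" for j
  proof -
    \<comment> \<open>For \<open>p > j div 2\<close> the second binomial coefficient vanishes, as \<open>j - p < p\<close>.\<close>
    have "(\<Sum>p=1..j div 2. \<Sum>r=0..p-1. ?f j p r) = (\<Sum>p=1..n. \<Sum>r=0..p-1. ?f j p r)"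
    proof (rule sum.mono_neutral_left)
      show "\<forall>p\<in>{1..n} - {1..j div 2}. (\<Sum>r=0..p-1. ?f j p r) = 0"
      proof
        fix p assume p: "p \<in> {1..n} - {1..j div 2}"
        then have "j - p < p" by auto
        then show "(\<Sum>r=0..p-1. ?f j p r) = 0" by (intro sum.neutral) (simp add: binomial_eq_0)
      qed
    qed (use that in auto)
    then show ?thesis by (simp add: atLeast0AtMost)
  qed
  have coeff: "(\<Sum>j=2..n. ?f j p r) =
      fps_nth (of_nat ((p - 1) choose r) * (fps_X ^ s p r * binomial_series (p - 1) (p + r))) n"
    if "1 \<le> p" "p \<le> n" "r \<le> p - 1" for p r
  proof -
    have sp: "1 \<le> s p r" "s p r \<le> n" using s[of r p] that by linarith+
    let ?g = "\<lambda>i. real ((n - s p r) choose i) * real ((i - (p - 1)) choose (p + r))"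
    have "(\<Sum>j=2..n. ?f j p r) = real ((p - 1) choose r) * (\<Sum>j=2..n. ?g (j - 1))"
      unfolding sum_distrib_left using that by (intro sum.cong) (auto simp: diff_diff_left)
    also have "(\<Sum>j=2..n. ?g (j - 1)) = (\<Sum>i=1..n-1. ?g i)"
      by (rule sum.reindex_bij_witness[of _ Suc "\<lambda>j. j - 1"]) auto
    \<comment> \<open>The term for \<open>i = 0\<close> is zero because \<open>p + r \<ge> 1\<close>.\<close>
    also have "\<dots> = (\<Sum>i\<le>n-1. ?g i)"
      using that by (intro sum.mono_neutral_left) (auto simp: not_less_eq_eq)
    also have "\<dots> = (\<Sum>i\<le>n - s p r. ?g i)"
      using sp by (intro sum.mono_neutral_right) (auto simp: binomial_eq_0)
    finally show ?thesis
      using sp by (simp add: binomial_series_def fps_X_power_mult_nth flip: fps_of_nat)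
  qed
  have "real (\<Sum>j=2..n. \<Sum>p=1..j div 2. \<Sum>r=0..p-1.
      ((p - 1) choose r) * ((j - p) choose (p + r)) * ((n - s p r) choose (j - 1))) =
      (\<Sum>j=2..n. \<Sum>p=1..n. \<Sum>r\<le>p-1. ?f j p r)"
    unfolding of_nat_sum of_nat_mult by (intro sum.cong refl extend) auto
  also have "\<dots> = (\<Sum>p=1..n. \<Sum>j=2..n. \<Sum>r\<le>p-1. ?f j p r)"
    by (rule sum.swap)
  also have "\<dots> = (\<Sum>p=1..n. \<Sum>r\<le>p-1. \<Sum>j=2..n. ?f j p r)"
    by (intro sum.cong refl sum.swap)
  also have "\<dots> = (\<Sum>p=1..n. \<Sum>r\<le>p-1.
      fps_nth (of_nat ((p - 1) choose r) * (fps_X ^ s p r * binomial_series (p - 1) (p + r))) n)"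
    using coeff by (intro sum.cong refl) auto
  finally show ?thesis by (simp add: fps_sum_nth)
qed

text \<open>Truncating the geometric series after \<open>n\<close> terms does not affect the coefficient at \<open>n\<close>: since \<open>R\<close> is divisible by \<open>fps_X\<close>,
the remainder is divisible by \<open>fps_X ^ (n + 2)\<close>.\<close>

lemma sum_geometric_eq_cubic_series:
  fixes Q R :: "real fps"
  defines "U \<equiv> inverse (1 - 2 * fps_X)"
  assumes R: "R = fps_X * R'"
  shows "fps_nth (\<Sum>p=1..n. fps_X ^ 2 * U ^ 2 * (R * U ^ 2) ^ (p - 1)) n = fps_nth (cubic_series R) n"
proof -
  let ?D = "(1 - 2 * fps_X) ^ 2 :: real fps"
  let ?S = "\<Sum>p=1..n. fps_X ^ 2 * U ^ 2 * (R * U ^ 2) ^ (p - 1)"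
  have U1: "U * (1 - 2 * fps_X) = 1" unfolding U_def by (rule inverse_one_minus_2X)
  then have U: "U ^ 2 * ?D = 1" by (simp flip: power_mult_distrib)
  have S: "?S = fps_X ^ 2 * U ^ 2 * (\<Sum>q<n. (R * U ^ 2) ^ q)"
    unfolding sum_distrib_left
    by (rule sum.reindex_bij_witness[of _ Suc "\<lambda>p. p - 1"]) auto
  have "?D - R = ?D * (1 - R * U ^ 2)"
    using U by (simp add: algebra_simps)
  then have "?S * (?D - R) = fps_X ^ 2 * (U ^ 2 * ?D) * ((1 - R * U ^ 2) * (\<Sum>q<n. (R * U ^ 2) ^ q))"
    unfolding S by (simp add: mult_ac)
  also have "\<dots> = fps_X ^ 2 * (1 - (R * U ^ 2) ^ n)"
    unfolding U by (simp add: one_diff_power_eq)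
  finally have mult: "?S * (?D - R) = fps_X ^ 2 * (1 - (R * U ^ 2) ^ n)" .
  have D0: "fps_nth (?D - R) 0 \<noteq> 0" by (simp add: R fps_power_zeroth)
  have "?S = ?S * (?D - R) * inverse (?D - R)"
    by (simp only: mult.assoc inverse_mult_eq_1'[OF D0] mult_1_right)
  also have "\<dots> = fps_X ^ 2 * (1 - (R * U ^ 2) ^ n) * inverse (?D - R)"
    by (simp only: mult)
  also have "\<dots> = cubic_series R - fps_X ^ (n + 2) * ((R' * U ^ 2) ^ n * inverse (?D - R))"
  proof -
    have "(R * U ^ 2) ^ n = fps_X ^ n * (R' * U ^ 2) ^ n"
      by (simp only: R power_mult_distrib mult.assoc)
    then show ?thesis
      by (simp only: cubic_series_def right_diff_distrib left_diff_distrib mult_1_right mult_1_left power_add mult_ac)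
  qed
  finally show ?thesis by (simp only: fps_sub_nth fps_X_power_mult_nth) simp
qed

text \<open>With \<open>U\<close> and \<open>V\<close> for $1/(1-2x)$ and $1/(1-x)$, the powers of $x$ in the summands do not depend on \<open>r\<close>. The binomial
theorem collects them into \<open>(U + 1) ^ (p - 1)\<close>, and \<open>V * (U + 1) = 2 * U\<close> absorbs the powers of \<open>V\<close>.\<close>

lemma triple_sum_212:
  assumes "n \<ge> 1"
  shows "real (\<Sum>j=2..n. \<Sum>p=1..j div 2. \<Sum>r=0..p-1.
      ((p - 1) choose r) * ((j - p) choose (p + r)) * ((n - p + r) choose (j - 1))) =
    fps_nth (cubic_series (2 * fps_X ^ 3)) n"
proof -
  define U V :: "real fps" where "U = inverse (1 - 2 * fps_X)" and "V = inverse (1 - fps_X)"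
  have U1: "U * (1 - 2 * fps_X) = 1" unfolding U_def by (rule inverse_one_minus_2X)
  have V1: "V * (1 - fps_X) = 1" unfolding V_def by (rule inverse_one_minus_X)
  have "V * (U + 1) = V * (U + U * (1 - 2 * fps_X))" by (simp only: U1)
  also have "\<dots> = 2 * U * (V * (1 - fps_X))" by (simp add: algebra_simps)
  finally have UV: "V * (U + 1) = 2 * U" by (simp add: V1)
  have inner: "(\<Sum>r\<le>p-1. of_nat ((p - 1) choose r) * (fps_X ^ (p - r) * binomial_series (p - 1) (p + r))) =
      fps_X ^ 2 * U ^ 2 * (2 * fps_X ^ 3 * U ^ 2) ^ (p - 1)" if p: "p \<ge> 1" for p
  proof -
    obtain q where q: "p = Suc q" using p by (cases p) auto
    have "(\<Sum>r\<le>q. of_nat (q choose r) * (fps_X ^ (p - r) * binomial_series q (p + r))) =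
        (\<Sum>r\<le>q. fps_X ^ (3 * q + 2) * V ^ q * U ^ (q + 2) * (of_nat (q choose r) * U ^ r * 1 ^ (q - r)))"
    proof (intro sum.cong refl)
      fix r assume "r \<in> {..q}"
      then have "fps_X ^ (p - r) * fps_X ^ (q + (p + r)) = (fps_X ^ (3 * q + 2) :: real fps)"
        by (simp add: q flip: power_add)
      then show "of_nat (q choose r) * (fps_X ^ (p - r) * binomial_series q (p + r)) =
          fps_X ^ (3 * q + 2) * V ^ q * U ^ (q + 2) * (of_nat (q choose r) * U ^ r * 1 ^ (q - r))"
        by (simp add: binomial_series_eq q flip: U_def V_def) (simp add: power_add algebra_simps)
    qed
    also have "\<dots> = fps_X ^ (3 * q + 2) * V ^ q * U ^ (q + 2) * (U + 1) ^ q"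
      by (simp only: binomial_ring sum_distrib_left)
    also have "\<dots> = fps_X ^ (3 * q + 2) * U ^ (q + 2) * (V * (U + 1)) ^ q"
      by (simp add: power_mult_distrib mult_ac)
    also have "\<dots> = fps_X ^ 2 * U ^ 2 * (2 * fps_X ^ 3 * U ^ 2) ^ q"
      unfolding UV
      by (simp only: power_add power_mult power2_eq_square power3_eq_cube power_mult_distrib mult_ac)
    finally show ?thesis by (simp add: q)
  qed
  have "real (\<Sum>j=2..n. \<Sum>p=1..j div 2. \<Sum>r=0..p-1.
      ((p - 1) choose r) * ((j - p) choose (p + r)) * ((n - p + r) choose (j - 1))) =
    real (\<Sum>j=2..n. \<Sum>p=1..j div 2. \<Sum>r=0..p-1.
      ((p - 1) choose r) * ((j - p) choose (p + r)) * ((n - (p - r)) choose (j - 1)))"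
    by (intro arg_cong[where f = real] sum.cong refl) auto
  also have "\<dots> = fps_nth (\<Sum>p=1..n. \<Sum>r\<le>p-1.
      of_nat ((p - 1) choose r) * (fps_X ^ (p - r) * binomial_series (p - 1) (p + r))) n"
    by (rule triple_sum_eq_fps_nth[where s = "\<lambda>p r. p - r", OF assms]) auto
  also have "\<dots> = fps_nth (\<Sum>p=1..n. fps_X ^ 2 * U ^ 2 * (2 * fps_X ^ 3 * U ^ 2) ^ (p - 1)) n"
    by (intro arg_cong[where f = "\<lambda>F. fps_nth F n"] sum.cong refl inner) simp
  also have "\<dots> = fps_nth (cubic_series (2 * fps_X ^ 3)) n"
    unfolding U_def
    by (rule sum_geometric_eq_cubic_series[where R' = "2 * fps_X ^ 2"])
      (simp add: power3_eq_cube power2_eq_square)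
  finally show ?thesis .
qed

text \<open>The shift by \<open>r + 1\<close> leaves a factor \<open>(fps_X ^ 2 * U) ^ r\<close> in the summands, so the binomial theorem yields a power of
\<open>fps_X ^ 2 * U + 1\<close>, whose product with \<open>V\<close> is \<open>U * (1 - fps_X)\<close>.\<close>

lemma triple_sum_312:
  assumes "n \<ge> 1"
  shows "real (\<Sum>j=2..n. \<Sum>p=1..j div 2. \<Sum>r=0..p-1.
      ((p - 1) choose r) * ((j - p) choose (p + r)) * ((n - r - 1) choose (j - 1))) =
    fps_nth (cubic_series (fps_X ^ 2 * (1 - fps_X))) n"
proof -
  define U V :: "real fps" where "U = inverse (1 - 2 * fps_X)" and "V = inverse (1 - fps_X)"
  have U1: "U * (1 - 2 * fps_X) = 1" unfolding U_def by (rule inverse_one_minus_2X)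
  have V1: "V * (1 - fps_X) = 1" unfolding V_def by (rule inverse_one_minus_X)
  have "V * (fps_X ^ 2 * U + 1) = V * (fps_X ^ 2 * U + U * (1 - 2 * fps_X))" by (simp only: U1)
  also have "\<dots> = U * (1 - fps_X) * (V * (1 - fps_X))"
    by (simp add: algebra_simps power2_eq_square)
  finally have UV: "V * (fps_X ^ 2 * U + 1) = U * (1 - fps_X)" by (simp add: V1)
  have inner: "(\<Sum>r\<le>p-1. of_nat ((p - 1) choose r) * (fps_X ^ Suc r * binomial_series (p - 1) (p + r))) =
      fps_X ^ 2 * U ^ 2 * (fps_X ^ 2 * (1 - fps_X) * U ^ 2) ^ (p - 1)" if p: "p \<ge> 1" for p
  proof -
    obtain q where q: "p = Suc q" using p by (cases p) auto
    have "(\<Sum>r\<le>q. of_nat (q choose r) * (fps_X ^ Suc r * binomial_series q (p + r))) =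
        (\<Sum>r\<le>q. fps_X ^ (2 * q + 2) * V ^ q * U ^ (q + 2) *
          (of_nat (q choose r) * (fps_X ^ 2 * U) ^ r * 1 ^ (q - r)))"
    proof (intro sum.cong refl)
      fix r
      have "fps_X ^ Suc r * fps_X ^ (q + (p + r)) = (fps_X ^ (2 * q + 2) * (fps_X ^ 2) ^ r :: real fps)"
        by (simp add: q mult_2 flip: power_add power_mult)
      then show "of_nat (q choose r) * (fps_X ^ Suc r * binomial_series q (p + r)) =
          fps_X ^ (2 * q + 2) * V ^ q * U ^ (q + 2) *
            (of_nat (q choose r) * (fps_X ^ 2 * U) ^ r * 1 ^ (q - r))"
        by (simp add: binomial_series_eq q flip: U_def V_def)
          (simp add: power_add power_mult_distrib algebra_simps)
    qed
    also have "\<dots> = fps_X ^ (2 * q + 2) * V ^ q * U ^ (q + 2) * (fps_X ^ 2 * U + 1) ^ q"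
      by (simp only: binomial_ring sum_distrib_left)
    also have "\<dots> = fps_X ^ (2 * q + 2) * U ^ (q + 2) * (V * (fps_X ^ 2 * U + 1)) ^ q"
      by (simp add: power_mult_distrib mult_ac)
    also have "\<dots> = fps_X ^ 2 * U ^ 2 * (fps_X ^ 2 * (1 - fps_X) * U ^ 2) ^ q"
      unfolding UV
      by (simp only: power_add power_mult power2_eq_square power_mult_distrib mult_ac)
    finally show ?thesis by (simp add: q)
  qed
  have "real (\<Sum>j=2..n. \<Sum>p=1..j div 2. \<Sum>r=0..p-1.
      ((p - 1) choose r) * ((j - p) choose (p + r)) * ((n - Suc r) choose (j - 1))) =
      fps_nth (\<Sum>p=1..n. \<Sum>r\<le>p-1.
        of_nat ((p - 1) choose r) * (fps_X ^ Suc r * binomial_series (p - 1) (p + r))) n"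
    by (rule triple_sum_eq_fps_nth[where s = "\<lambda>p r. Suc r", OF assms]) auto
  also have "\<dots> = fps_nth (\<Sum>p=1..n.
      fps_X ^ 2 * U ^ 2 * (fps_X ^ 2 * (1 - fps_X) * U ^ 2) ^ (p - 1)) n"
    by (intro arg_cong[where f = "\<lambda>F. fps_nth F n"] sum.cong refl inner) simp
  also have "\<dots> = fps_nth (cubic_series (fps_X ^ 2 * (1 - fps_X))) n"
    unfolding U_def
    by (rule sum_geometric_eq_cubic_series[where R' = "fps_X * (1 - fps_X)"])
      (simp add: power2_eq_square mult.assoc)
  finally show ?thesis by simp
qed

section \<open>The two patterns\<close>

interpretation p212: valley_pattern "[2, 1, 2]" "\<lambda>s. s = 1"
  by standard (auto simp: order_isomorphic_three)

text \<open>The condition \<open>s \<noteq> 1\<close> stands for \<open>s \<ge> 2\<close>, since only descents, with \<open>s \<ge> 1\<close>, are tested.\<close>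

interpretation p312: valley_pattern "[3, 1, 2]" "\<lambda>s. s \<noteq> 1"
  by standard (auto simp: order_isomorphic_three)

theorem corollary3p4:
  fixes n :: nat
  shows "(n \<ge> 2 \<longrightarrow>
            real (tot n [2, 1, 2]) = (real n - 2) * (3 powi (int n - 3) - 1) / 4 \<and>
            real (tot n [3, 1, 2]) = ((real n - 5) * 3 powi (int n - 3) + real n - 1) / 4) \<and>
         (n \<ge> 1 \<longrightarrow>
            num_avoiding n [2, 1, 2] =
              1 + (\<Sum>j=2..n. \<Sum>p=1..j div 2. \<Sum>r=0..p-1.
                     ((p - 1) choose r) * ((j - p) choose (p + r)) * ((n - p + r) choose (j - 1))) \<and>
            num_avoiding n [3, 1, 2] =
              1 + (\<Sum>j=2..n. \<Sum>p=1..j div 2. \<Sum>r=0..p-1.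
                     ((p - 1) choose r) * ((j - p) choose (p + r)) * ((n - r - 1) choose (j - 1))))"
    (is "_ \<and> (_ \<longrightarrow> _ = 1 + ?S212 \<and> _ = 1 + ?S312)")
proof (intro conjI impI)
  assume "n \<ge> 2"
  then obtain k where n: "n = Suc (Suc k)" using that[of "n - 2"] by simp
  have pow: "(3 :: real) powi (int n - 3) = 3 ^ k / 3"
    using power_int_diff[of "3 :: real" "int k" 1] by (simp add: n)
  show "real (tot n [2, 1, 2]) = (real n - 2) * (3 powi (int n - 3) - 1) / 4"
    unfolding pow unfolding n p212.tot_eq_total p212.total_one_step_descents[OF refl order_refl]
    by simp
  show "real (tot n [3, 1, 2]) = ((real n - 5) * 3 powi (int n - 3) + real n - 1) / 4"
    unfolding pow unfolding n p312.tot_eq_total p312.total_longer_descents[OF refl order_refl]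
    by simp
next
  assume n1: "n \<ge> 1"
  then obtain k where n: "n = Suc k" by (cases n) auto
  have "real (num_avoiding n [2, 1, 2]) = real (1 + ?S212)"
    unfolding of_nat_add triple_sum_212[OF n1]
    unfolding n p212.num_avoiding_eq_avoiders p212.avoiders_one_step_descents[OF refl order_refl]
    by simp
  then show "num_avoiding n [2, 1, 2] = 1 + ?S212" by (simp only: of_nat_eq_iff)
  have "real (num_avoiding n [3, 1, 2]) = real (1 + ?S312)"
    unfolding of_nat_add triple_sum_312[OF n1]
    unfolding n p312.num_avoiding_eq_avoiders p312.avoiders_longer_descents[OF refl order_refl]
    by simp
  then show "num_avoiding n [3, 1, 2] = 1 + ?S312" by (simp only: of_nat_eq_iff)
qed

end
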